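(* Let $N\ge 1$, $P>0$, let $J\in\mathbb{R}^{2N\times 2N}$ be nonsingular and skew-symmetric ($J^T=-J$), and let $H:\mathbb{R}\to\mathbb{R}^{2N\times 2N}$ satisfy $H(t)^T=H(t)=H(t+P)$ for all $t$. Let $X(t)$, $t\ge 0$, be the fundamental solution of the Hamiltonian system, i.e. $J\,\frac{dX(t)}{dt}=H(t)X(t)$ for $t>0$ and $X(0)=I_{2N}$. Let $u\in\mathbb{R}^{2N}$ be a constant vector and put $$E(t)=(Juu^TH(t))^T+Juu^TH(t)+(uu^TJ)^TH(t)(uu^TJ).$$ Then $\widetilde{X}(t)=(I+uu^TJ)X(t)$ is a solution of the perturbed Hamiltonian system $$J\,\frac{d\widetilde{X}(t)}{dt}=\left[H(t)+E(t)\right]\widetilde{X}(t).$$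
   Context: $I=I_{2N}$ is the identity matrix and $^T$ denotes transpose. The fundamental solution $X:[0,\infty)\to\mathbb{R}^{2N\times 2N}$ is continuous on $[0,\infty)$ and differentiable for $t>0$. *)

theory Defs
  imports "HOL-Analysis.Analysis"
begin

(* u u^T.  The column count of columnvector u is a free type, so it is fixed to 1 here. *)
definition self_outer :: "real ^ 'n \<Rightarrow> real ^ 'n ^ 'n" where
  "self_outer u =
     (columnvector u :: real ^ 1 ^ 'n) ** transpose (columnvector u :: real ^ 1 ^ 'n)"

(* Only the values of X on [0,\<infinity>) matter: at t > 0 the two-sided derivative is a
   local notion inside that interval. *)
definition hamiltonian_solution ::
    "real ^ 'n ^ 'n \<Rightarrow> (real \<Rightarrow> real ^ 'n ^ 'n) \<Rightarrow> (real \<Rightarrow> real ^ 'n ^ 'n) \<Rightarrow> bool" where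
  "hamiltonian_solution J H X \<longleftrightarrow>
     continuous_on {0..} X \<and>
     (\<forall>t>0. \<exists>X'. (X has_vector_derivative X') (at t) \<and> J ** X' = H t ** X t)"

definition fundamental_solution ::
    "real ^ 'n ^ 'n \<Rightarrow> (real \<Rightarrow> real ^ 'n ^ 'n) \<Rightarrow> (real \<Rightarrow> real ^ 'n ^ 'n) \<Rightarrow> bool" where
  "fundamental_solution J H X \<longleftrightarrow> hamiltonian_solution J H X \<and> X 0 = mat 1"

end

theory Submission
  imports Defs
begin

text \<open>Write \<open>S = u u\<^sup>T\<close>. Since \<open>J\<close> is skew-symmetric, \<open>u\<^sup>T J u = 0\<close> and hence \<open>S J S = 0\<close>.
  This turns the perturbed coefficient into \<open>H + E = (I + J S) H (I - S J)\<close>, where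
  \<open>I - S J\<close> is the inverse of \<open>I + S J\<close>; the claim then follows from
  \<open>J (I + S J) = (I + J S) J\<close>.\<close>

lemma matrix_mul_add_rdistrib:
  "(A + B :: 'a::semiring_1 ^ 'n ^ 'm) ** C = A ** C + B ** C"
  by (simp add: matrix_matrix_mult_def vec_eq_iff distrib_right sum.distrib)

lemma matrix_mul_diff_rdistrib:
  "(A - B :: 'a::ring_1 ^ 'n ^ 'm) ** C = A ** C - B ** C"
  by (simp add: matrix_matrix_mult_def vec_eq_iff left_diff_distrib sum_subtractf)

lemma matrix_mul_uminus_left: "(- A :: 'a::ring_1 ^ 'n ^ 'm) ** B = - (A ** B)"
  by (simp add: matrix_matrix_mult_def vec_eq_iff sum_negf)

lemma matrix_mul_uminus_right: "(A :: 'a::ring_1 ^ 'n ^ 'm) ** (- B) = - (A ** B)"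
  by (simp add: matrix_matrix_mult_def vec_eq_iff sum_negf)

lemma transpose_self_outer: "transpose (self_outer u) = self_outer u"
  by (simp add: self_outer_def matrix_transpose_mul)

text \<open>Regrouping the product around its middle isolates the scalar
  \<open>u\<^sup>T J u\<close>, the quadratic form of a skew-symmetric matrix, which
  vanishes.\<close>

lemma self_outer_skew_self_outer:
  fixes J :: "real ^ 'n ^ 'n"
  assumes "transpose J = - J"
  shows "self_outer u ** J ** self_outer u = 0"
proof -
  define c :: "real ^ 1 ^ 'n" where "c = columnvector u"
  define q where "q = transpose c ** J ** c"
  have "transpose q = - q"
    by (simp add: q_def matrix_transpose_mul assms matrix_mul_uminus_left
        matrix_mul_uminus_right matrix_mul_assoc)
  \<comment> \<open>Being 1 by 1, \<open>q\<close> equals its own transpose, so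
    \<open>q = - q\<close>.\<close>
  then have "q = 0"
    by (simp add: vec_eq_iff transpose_def)
  have "self_outer u ** J ** self_outer u = c ** q ** transpose c"
    by (simp add: self_outer_def c_def q_def matrix_mul_assoc)
  with \<open>q = 0\<close> show ?thesis
    by simp
qed

text \<open>Linearity suffices in finite dimension. Boundedness lets continuity and derivatives pass
  from \<open>X\<close> to its product with a constant matrix.\<close>

lemma bounded_linear_matrix_mul_left:
  "bounded_linear (\<lambda>B :: real ^ 'k ^ 'n. (A :: real ^ 'n ^ 'm) ** B)"
  unfolding linear_conv_bounded_linear[symmetric]
  by (rule linearI) (simp_all add: matrix_add_ldistrib matrix_scalar_ac scalar_matrix_assoc)

theorem proposition11:
  fixes N :: nat and P :: real
    and J :: "real ^ 'n ^ 'n"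
    and H E X :: "real \<Rightarrow> real ^ 'n ^ 'n"
    and u :: "real ^ 'n"
  assumes "N \<ge> 1" and "CARD('n) = 2 * N" and "P > 0"
    and "invertible J" and "transpose J = - J"
    and "\<And>t. transpose (H t) = H t" and "\<And>t. H (t + P) = H t"
    and "fundamental_solution J H X"
    and "\<And>t. E t = transpose (J ** self_outer u ** H t) + J ** self_outer u ** H t
               + transpose (self_outer u ** J) ** H t ** (self_outer u ** J)"
  shows "hamiltonian_solution J (\<lambda>t. H t + E t) (\<lambda>t. (mat 1 + self_outer u ** J) ** X t)"
proof -
  define S where "S = self_outer u"
  note neg = matrix_mul_uminus_left matrix_mul_uminus_right
  have SJS: "S ** J ** S = 0"
    unfolding S_def by (rule self_outer_skew_self_outer[OF assms(5)])
  \<comment> \<open>Both minus signs come from transposing \<open>J\<close>; \<open>S\<close> and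
    \<open>H t\<close> are symmetric.\<close>
  have E: "E t = - (H t ** S ** J) + J ** S ** H t - J ** S ** H t ** S ** J" for t
    unfolding assms(9) S_def[symmetric]
    by (simp add: matrix_transpose_mul assms(5,6) S_def transpose_self_outer
        neg matrix_mul_assoc)
  have factor: "(H t + E t) ** (mat 1 + S ** J) = (mat 1 + J ** S) ** H t" for t
  proof -
    \<comment> \<open>\<open>SJS\<close> in the left-nested form that
      \<open>matrix_mul_assoc\<close> produces. It is needed for \<open>A = H t\<close> and
      \<open>A = J ** S ** H t\<close>; the other surplus terms of the expansion cancel in
      pairs.\<close>
    have "A ** S ** J ** S ** J = 0" for A :: "real ^ 'n ^ 'n"
      using SJS by (metis matrix_mul_assoc times0_left times0_right)
    then show ?thesis
      by (simp add: E matrix_add_ldistrib matrix_mul_add_rdistrib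
          matrix_mul_diff_rdistrib neg matrix_mul_assoc)
  qed
  have comm: "J ** (mat 1 + S ** J) = (mat 1 + J ** S) ** J"
    by (simp add: matrix_add_ldistrib matrix_mul_add_rdistrib matrix_mul_assoc)
  have sol: "continuous_on {0..} X"
    "\<And>t. t > 0 \<Longrightarrow> \<exists>X'. (X has_vector_derivative X') (at t) \<and> J ** X' = H t ** X t"
    using assms(8) by (auto simp: fundamental_solution_def hamiltonian_solution_def)
  note lin = bounded_linear_matrix_mul_left[of "mat 1 + S ** J"]
  show ?thesis
    unfolding hamiltonian_solution_def S_def[symmetric]
  proof (intro conjI allI impI)
    show "continuous_on {0..} (\<lambda>t. (mat 1 + S ** J) ** X t)"
      by (rule bounded_linear.continuous_on[OF lin sol(1)])
  next
    fix t :: real assume "t > 0"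
    then obtain X' where X': "(X has_vector_derivative X') (at t)" "J ** X' = H t ** X t"
      using sol(2) by blast
    \<comment> \<open>By \<open>comm\<close>, the equation for \<open>X'\<close> and
      \<open>factor\<close>, both sides equal \<open>(mat 1 + J ** S) ** H t ** X t\<close>.\<close>
    have "J ** ((mat 1 + S ** J) ** X') = (H t + E t) ** ((mat 1 + S ** J) ** X t)"
      by (metis X'(2) comm factor matrix_mul_assoc)
    with bounded_linear.has_vector_derivative[OF lin X'(1)]
    show "\<exists>Y'. ((\<lambda>t. (mat 1 + S ** J) ** X t) has_vector_derivative Y') (at t) \<and>
        J ** Y' = (H t + E t) ** ((mat 1 + S ** J) ** X t)"
      by blast
  qed
qed

end
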